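(* (1) If $n\equiv 1 \pmod 4$ and $\phi$ is an $\frac{n+1}{2}$-isometry of $\mathcal{C}_n$ fixing $\overline{0}$, such that $\phi$ is not an isometry, then $\phi$ is a $\sigma_{i,j}$-mapping on $\mathcal{C}_n$ (for some $i,j\in\{1,\ldots,n\}$ and some bijection $\sigma$). Conversely, for $n\equiv 1\pmod 4$, every $\sigma_{i,j}$-mapping on $\mathcal{C}_n$ is an $\frac{n+1}{2}$-isometry. (2) If $n\equiv 3 \pmod 4$ and $\phi$ is an $\frac{n+1}{2}$-isometry of $\mathcal{C}_n$ fixing $\overline{0}$, such that $\phi$ is not an even isometry, then one of the following three possibilities holds: \begin{itemize} \item[I)] there is a $\sigma_{i,j}$-mapping $\tau$ on $\mathcal{C}_n$ and an even weight word $\overline{a}$, such that $\phi$ acts as an even isometry on the words of even weight and as $T_{\overline{a}}\circ\tau$ on the words of odd weight; \item[II)] there is a $\sigma_{i,j}$-mapping $\tau$ on $\mathcal{C}_n$, such that $\phi$ acts as $\tau$ on the words of even weight and as an even isometry on the words of odd weight; \item[III)] there is a $\sigma_{i,j}$-mapping $\tau_1$ on $\mathcal{C}_n$, a $\sigma_{k,l}$-mapping $\tau_2$ on $\mathcal{C}_n$ (its underlying bijection not assumed to be the one of $\tau_1$), and an even weight word $\overline{a}$, such that $\phi$ acts as $\tau_1$ on the words of even weight and as $T_{\overline{a}}\circ\tau_2$ on the words of odd weight. \end{itemize}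
   Context: $\mathcal{C}_n=\{0,1\}^n$ is the Boolean cube with Hamming distance $d$ and component-wise addition modulo $2$; $\overline{0}=(0,\ldots,0)$. The weight of a word is its number of non-zero positions. $T_{\overline{a}}$ is the translation $\overline{c}\mapsto\overline{c}+\overline{a}$. For $p\in\{1,\ldots,n\}$, a $p$-isometry is a bijection $\phi$ of $\mathcal{C}_n$ such that $d(\phi(x),\phi(y))=p$ whenever $d(x,y)=p$. An isometry is a bijection preserving all distances; an even isometry is a bijection that is a $p$-isometry for every even $p\in\{1,\ldots,n\}$. "$\phi$ acts as an even isometry on the words of even (odd) weight" means that the restriction of $\phi$ to these words coincides with the restriction of some even isometry. Let $i,j\in\{1,\ldots,n\}$ (possibly equal) and let $\sigma$ be a bijection from $\{1,\ldots,n\}\setminus\{i\}$ to $\{1,\ldots,n\}\setminus\{j\}$. The corresponding $\sigma_{i,j}$-mapping on $\mathcal{C}_n$ is the map $\overline{c}=(c_1,\ldots,c_n)\mapsto(d_1,\ldots,d_n)$ where: if $c_i=0$, then $d_k=c_{\sigma^{-1}(k)}$ for $k\neq j$ and $d_j=0$; if $c_i=1$, then $d_k=c_{\sigma^{-1}(k)}+1$ for $k\neq j$ and $d_j=1$. Saying that a map is a $\sigma_{i,j}$-mapping without specifying data means that such $i,j,\sigma$ exist. *)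

theory Defs
  imports "HOL-Analysis.Finite_Cartesian_Product" "HOL-Library.Z2"
begin

text \<open>
  The cube \<open>{0,1}^n\<close> is the type \<^typ>\<open>bit ^ 'n\<close> with \<open>n = CARD('n)\<close>; the positions are the
  elements of the finite type \<open>'n\<close>, on which no ordering is used. Addition of words is the
  library's component-wise addition over the field \<^typ>\<open>bit\<close>, and \<open>0\<close> is the zero word.
\<close>

type_synonym 'n word = "bit ^ 'n"

definition weight :: "'n::finite word \<Rightarrow> nat" where
  "weight c = card {k. c $ k \<noteq> 0}"

definition hdist :: "'n::finite word \<Rightarrow> 'n word \<Rightarrow> nat" where
  "hdist x y = card {k. x $ k \<noteq> y $ k}"

definition translation :: "'n::finite word \<Rightarrow> 'n word \<Rightarrow> 'n word" where
  "translation a = (\<lambda>c. c + a)"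

definition p_isometry :: "nat \<Rightarrow> ('n::finite word \<Rightarrow> 'n word) \<Rightarrow> bool" where
  "p_isometry p \<phi> \<longleftrightarrow>
     p \<in> {1..CARD('n)} \<and> bij \<phi> \<and> (\<forall>x y. hdist x y = p \<longrightarrow> hdist (\<phi> x) (\<phi> y) = p)"

definition isometry :: "('n::finite word \<Rightarrow> 'n word) \<Rightarrow> bool" where
  "isometry \<phi> \<longleftrightarrow> bij \<phi> \<and> (\<forall>x y. hdist (\<phi> x) (\<phi> y) = hdist x y)"

definition even_isometry :: "('n::finite word \<Rightarrow> 'n word) \<Rightarrow> bool" where
  "even_isometry \<phi> \<longleftrightarrow> bij \<phi> \<and> (\<forall>p\<in>{1..CARD('n)}. even p \<longrightarrow> p_isometry p \<phi>)"

definition acts_as_on :: "('n::finite word \<Rightarrow> 'n word) \<Rightarrow> ('n word \<Rightarrow> 'n word) \<Rightarrow> 'n word set \<Rightarrow> bool" where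
  "acts_as_on \<phi> \<psi> W \<longleftrightarrow> (\<forall>c\<in>W. \<phi> c = \<psi> c)"

definition acts_as_even_isometry_on :: "('n::finite word \<Rightarrow> 'n word) \<Rightarrow> 'n word set \<Rightarrow> bool" where
  "acts_as_even_isometry_on \<phi> W \<longleftrightarrow> (\<exists>\<psi>. even_isometry \<psi> \<and> acts_as_on \<phi> \<psi> W)"

definition even_words :: "'n::finite word set" where
  "even_words = {c. even (weight c)}"

definition odd_words :: "'n::finite word set" where
  "odd_words = {c. odd (weight c)}"

text \<open>
  Only the values of \<open>\<sigma>\<close> on the positions other than \<open>i\<close> matter. In the map below,
  \<open>inv_into (- {i}) \<sigma>\<close> is the inverse of the bijection \<open>\<sigma>\<close> from \<open>- {i}\<close> onto \<open>- {j}\<close>.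
\<close>

definition sigma_map :: "'n::finite \<Rightarrow> 'n \<Rightarrow> ('n \<Rightarrow> 'n) \<Rightarrow> 'n word \<Rightarrow> 'n word" where
  "sigma_map i j \<sigma> c =
     (if c $ i = 0
      then (\<chi> k. if k = j then 0 else c $ inv_into (- {i}) \<sigma> k)
      else (\<chi> k. if k = j then 1 else c $ inv_into (- {i}) \<sigma> k + 1))"

definition is_sigma_mapping :: "('n::finite word \<Rightarrow> 'n word) \<Rightarrow> bool" where
  "is_sigma_mapping \<tau> \<longleftrightarrow>
     (\<exists>i j \<sigma>. bij_betw \<sigma> (- {i}) (- {j}) \<and> \<tau> = sigma_map i j \<sigma>)"

end

theory Submission
  imports Defs
begin

text \<open>
  Write \<open>n = CARD('n)\<close>, assume \<open>n\<close> odd, and put \<open>N = n + 1 = 2 p\<close>. Add one position, \<open>None\<close>, on which every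
  word is zero, and read the resulting word of length \<open>N\<close> up to complement: the cube becomes the
  quotient of the power set of \<open>'n option\<close> by complementation, the folded cube of dimension \<open>N\<close>. All
  \<open>N\<close> positions now have equal rights, and a distance \<open>d\<close> in the folded cube is determined only up to
  exchanging \<open>d\<close> with \<open>N - d\<close>. The distance \<open>p\<close> is its own partner. Hence every permutation of the
  \<open>N\<close> positions induces a \<open>p\<close>-isometry of the cube. The permutations that fix \<open>None\<close> give the coordinate
  permutations, which are isometries; the others give exactly the \<open>\<sigma>\<close>-mappings
  (\<open>is_sigma_mapping_iff\<close>). The theorem thus says that, up to translations and up to separating
  the words of even weight from those of odd weight, there are no other \<open>p\<close>-isometries.

  The proof looks at the graph that joins two sets at distance \<open>p\<close>. Two sets at distance \<open>d\<close> have no common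
  neighbour if \<open>d\<close> is odd, and \<open>(d choose d/2) * (N-d choose (N-d)/2)\<close> of them if \<open>d\<close> is even. As the
  central binomial coefficients are strictly log-convex, this number strictly decreases for even \<open>d\<close>
  from \<open>0\<close> to \<open>p\<close>. A \<open>p\<close>-isometry therefore preserves parity and all even folded distances
  (\<open>p_preserving_fdist\<close>).

  For \<open>N \<ge> 8\<close> the sets of size \<open>2\<close>, with two of them joined when they share a point, form the
  triangular graph. The sets that contain a given point are recognisable in it as the large families of
  pairwise intersecting pairs, so the isometry permutes the positions by some \<open>\<pi>\<close>
  (\<open>perm_on_pairs\<close>), and the distances to the pairs determine every set of even size up to complement
  (\<open>even_sets_if_pairs\<close>). For \<open>N = 6\<close> all even folded distances between distinct classes coincide; there
  the odd ones are preserved as well, and the singletons take over the role of the pairs.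

  If \<open>p\<close> is odd, then the neighbours of a set of odd size have even size, so they are already known, and
  they determine the set. This gives the first part. If \<open>p\<close> is even, then no edge connects the two
  parities. The words of odd weight are handled by translating them into words of even weight; this yields
  a second, independent permutation and a translation. The three cases of the second part record
  which of the two permutations move \<open>None\<close>; if neither does, the map is an even isometry.
\<close>

section \<open>Folded distance between sets\<close>

definition sdist :: "'a set \<Rightarrow> 'a set \<Rightarrow> nat" where
  "sdist S T = card (sym_diff S T)"

text \<open>
  Complementing one of the two sets turns the distance \<open>d\<close> into \<open>CARD('a) - d\<close>; the minimum forgets
  which of the two values occurred.
\<close>

definition fdist :: "'a::finite set \<Rightarrow> 'a set \<Rightarrow> nat" where
  "fdist S T = min (sdist S T) (CARD('a) - sdist S T)"

lemma sdist_commute: "sdist S T = sdist T S"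
  by (simp add: sdist_def Un_commute)

lemma sdist_empty [simp]: "sdist S {} = card S" "sdist {} S = card S"
  by (simp_all add: sdist_def)

lemma sdist_self [simp]: "sdist S S = 0"
  by (simp add: sdist_def)

lemma sdist_le_CARD: "sdist S T \<le> CARD('a)" for S T :: "'a::finite set"
  by (simp add: sdist_def card_mono)

lemma sdist_eq_0_iff: "sdist S T = 0 \<longleftrightarrow> S = T" for S T :: "'a::finite set"
  by (auto simp: sdist_def)

lemma sdist_Compl_left: "sdist (- S) T = CARD('a) - sdist S T" for S T :: "'a::finite set"
proof -
  have "sym_diff (- S) T = - sym_diff S T" by auto
  then show ?thesis by (simp add: sdist_def Compl_eq_Diff_UNIV card_Diff_subset)
qed

lemma sdist_Compl_right: "sdist S (- T) = CARD('a) - sdist S T" for S T :: "'a::finite set"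
  using sdist_Compl_left[of T S] by (simp add: sdist_commute)

lemma sdist_image: "inj f \<Longrightarrow> sdist (f ` S) (f ` T) = sdist S T"
  by (simp add: sdist_def image_set_diff[symmetric] image_Un[symmetric] card_image inj_on_subset)

lemma card_eq_sdist: "card S + card T = sdist S T + 2 * card (S \<inter> T)"
  for S T :: "'a::finite set"
proof -
  have "card S = card (S - T) + card (S \<inter> T)" "card T = card (T - S) + card (S \<inter> T)"
    by (subst card_Un_disjoint[symmetric]; auto intro!: arg_cong[of _ _ card])+
  moreover have "sdist S T = card (S - T) + card (T - S)"
    unfolding sdist_def by (subst card_Un_disjoint) auto
  ultimately show ?thesis by simp
qed

lemma even_sdist_iff: "even (sdist S T) \<longleftrightarrow> (even (card S) \<longleftrightarrow> even (card T))"
  for S T :: "'a::finite set"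
  using arg_cong[OF card_eq_sdist[of S T], of even] by auto

text \<open>
  These three values are what makes a pair \<open>{a, b}\<close> a probe: the distance to it tells whether
  \<open>a\<close> and \<open>b\<close> lie on the same side of \<open>T\<close>, and on which.
\<close>

lemma sdist_pair:
  fixes T :: "'a::finite set"
  assumes "a \<noteq> b"
  shows "a \<in> T \<Longrightarrow> b \<in> T \<Longrightarrow> sdist T {a, b} + 2 = card T"
    and "a \<notin> T \<Longrightarrow> b \<notin> T \<Longrightarrow> sdist T {a, b} = card T + 2"
    and "(a \<in> T) \<noteq> (b \<in> T) \<Longrightarrow> sdist T {a, b} = card T"
proof -
  note c = card_eq_sdist[of T "{a, b}"]
  show "a \<in> T \<Longrightarrow> b \<in> T \<Longrightarrow> sdist T {a, b} + 2 = card T" using c assms by simp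
  show "a \<notin> T \<Longrightarrow> b \<notin> T \<Longrightarrow> sdist T {a, b} = card T + 2" using c assms by simp
  show "(a \<in> T) \<noteq> (b \<in> T) \<Longrightarrow> sdist T {a, b} = card T" using c assms by auto
qed

lemma fdist_Compl [simp]:
  "fdist (- S) T = fdist S T" "fdist S (- T) = fdist S T" for S T :: "'a::finite set"
  using sdist_le_CARD[of S T] by (simp_all add: fdist_def sdist_Compl_left sdist_Compl_right)

lemma fdist_eq_iff:
  fixes S T :: "'a::finite set" and S' T' :: "'a set"
  shows "fdist S T = fdist S' T' \<longleftrightarrow>
    sdist S T = sdist S' T' \<or> sdist S T + sdist S' T' = CARD('a)"
  using sdist_le_CARD[of S T] sdist_le_CARD[of S' T'] by (auto simp: fdist_def)

section \<open>Common neighbours at half distance\<close>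

definition common_nbrs :: "nat \<Rightarrow> 'a set \<Rightarrow> 'a set \<Rightarrow> 'a set set" where
  "common_nbrs p S T = {Z. sdist S Z = p \<and> sdist T Z = p}"

lemma card_subsets_split:
  fixes D :: "'a::finite set"
  shows "card {W. card (W \<inter> D) = k \<and> card (W - D) = l}
    = (card D choose k) * ((CARD('a) - card D) choose l)"
proof -
  have "card {W. card (W \<inter> D) = k \<and> card (W - D) = l}
      = card ({A. A \<subseteq> D \<and> card A = k} \<times> {B. B \<subseteq> - D \<and> card B = l})"
  proof (rule bij_betw_same_card[of "\<lambda>W. (W \<inter> D, W - D)"],
      rule bij_betw_byWitness[where f' = "\<lambda>(A, B). A \<union> B"])
    show "(\<lambda>(A, B). A \<union> B) ` ({A. A \<subseteq> D \<and> card A = k} \<times> {B. B \<subseteq> - D \<and> card B = l})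
        \<subseteq> {W. card (W \<inter> D) = k \<and> card (W - D) = l}"
    proof clarify
      fix A B assume "A \<subseteq> D" "B \<subseteq> - D"
      then have "(A \<union> B) \<inter> D = A" "(A \<union> B) - D = B" by auto
      then show "card ((A \<union> B) \<inter> D) = card A \<and> card ((A \<union> B) - D) = card B" by simp
    qed
  qed auto
  also have "\<dots> = (card D choose k) * (card (- D) choose l)"
    by (simp add: card_cartesian_product n_subsets)
  finally show ?thesis by (simp add: Compl_eq_Diff_UNIV card_Diff_subset)
qed

text \<open>
  After translating \<open>S\<close> to the empty set, a common neighbour is a set of size \<open>p\<close> at distance \<open>p\<close> from
  \<open>D = sym_diff S T\<close>. This forces it to contain exactly half of \<open>D\<close>, so its two parts inside and outside
  \<open>D\<close> can be chosen independently.
\<close>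

lemma card_common_nbrs:
  fixes S T :: "'a::finite set"
  assumes N: "CARD('a) = 2 * p"
  shows "card (common_nbrs p S T) =
    (if even (sdist S T)
     then (sdist S T choose (sdist S T div 2)) *
       ((2 * p - sdist S T) choose (p - sdist S T div 2))
     else 0)"
proof -
  define D where "D = sym_diff S T"
  have cD: "card D = sdist S T" by (simp add: D_def sdist_def)
  have le: "card D \<le> 2 * p" using sdist_le_CARD[of S T] by (simp add: cD N)
  have "bij_betw (sym_diff S) (common_nbrs p S T) {W. card W = p \<and> sdist D W = p}"
  proof (rule bij_betw_byWitness[where f' = "sym_diff S"])
    have cancel: "sym_diff A (sym_diff A B) = B" for A B :: "'a set" by blast
    have shift: "sym_diff (sym_diff A B) C = sym_diff B (sym_diff A C)" for A B C :: "'a set"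
      by blast
    have "sym_diff D W = sym_diff T (sym_diff S W)" "sym_diff D (sym_diff S W) = sym_diff T W"
      "sym_diff S (sym_diff S W) = W" for W
      by (simp_all only: D_def cancel shift)
    then show "\<forall>Z\<in>common_nbrs p S T. sym_diff S (sym_diff S Z) = Z"
      "\<forall>W\<in>{W. card W = p \<and> sdist D W = p}. sym_diff S (sym_diff S W) = W"
      "sym_diff S ` common_nbrs p S T \<subseteq> {W. card W = p \<and> sdist D W = p}"
      "sym_diff S ` {W. card W = p \<and> sdist D W = p} \<subseteq> common_nbrs p S T"
      unfolding common_nbrs_def sdist_def by (auto simp only:)
  qed
  then have "card (common_nbrs p S T) = card {W. card W = p \<and> sdist D W = p}"
    by (rule bij_betw_same_card)
  also have "{W. card W = p \<and> sdist D W = p}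
      = {W. even (card D) \<and> card (W \<inter> D) = card D div 2 \<and> card (W - D) = p - card D div 2}"
  proof (intro Collect_cong)
    fix W :: "'a set"
    have "card W = card (W \<inter> D) + card (W - D)"
      by (subst card_Un_disjoint[symmetric]) (auto intro!: arg_cong[of _ _ card])
    moreover have "card D + card W = sdist D W + 2 * card (W \<inter> D)"
      using card_eq_sdist[of D W] by (simp add: Int_commute)
    ultimately show "(card W = p \<and> sdist D W = p) \<longleftrightarrow>
        even (card D) \<and> card (W \<inter> D) = card D div 2 \<and> card (W - D) = p - card D div 2"
      using le by auto
  qed
  also have "card \<dots> = (if even (card D) then (card D choose (card D div 2)) *
       ((CARD('a) - card D) choose (p - card D div 2)) else 0)"
    using card_subsets_split[of D] by auto
  finally show ?thesis by (simp add: cD N)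
qed

text \<open>
  This is the ratio \<open>2 * (2 * k + 1) / (k + 1)\<close> of consecutive central binomial coefficients.
\<close>

lemma central_binomial_Suc:
  "Suc k * ((2 * Suc k) choose Suc k) = 2 * (2 * k + 1) * ((2 * k) choose k)"
proof -
  have 1: "Suc k * (Suc (Suc (2 * k)) choose Suc k) = Suc (Suc (2 * k)) * (Suc (2 * k) choose k)"
    by (rule Suc_times_binomial)
  have "Suc (2 * k) choose k = Suc (2 * k) choose Suc k"
    using binomial_symmetric[of k "Suc (2 * k)"] by (simp add: Suc_diff_le)
  then have 2: "Suc k * (Suc (2 * k) choose k) = Suc (2 * k) * ((2 * k) choose k)"
    by (metis Suc_times_binomial)
  have "Suc k * (Suc k * ((2 * Suc k) choose Suc k))
      = Suc (Suc (2 * k)) * (Suc k * (Suc (2 * k) choose k))"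
    using 1 by (simp only: mult.left_commute mult_2 add_Suc add_Suc_right)
  also have "\<dots> = Suc k * (2 * (2 * k + 1) * ((2 * k) choose k))"
    unfolding 2 by (simp add: algebra_simps)
  finally show ?thesis by (simp only: mult_cancel1) simp
qed

text \<open>
  The ratio of consecutive central binomial coefficients is \<open>4 - 2 / (k + 1)\<close>, which increases with
  \<open>k\<close>.
\<close>

lemma central_binomial_log_convex:
  assumes "k < m"
  shows "((2 * Suc k) choose Suc k) * ((2 * m) choose m)
    < ((2 * k) choose k) * ((2 * Suc m) choose Suc m)"
proof -
  define C where "C k = (2 * k) choose k" for k :: nat
  have S: "Suc k * C (Suc k) = 2 * (2 * k + 1) * C k" for k
    unfolding C_def by (rule central_binomial_Suc)
  have pos: "C k * C m > 0" by (simp add: C_def)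
  have "Suc m * Suc k * (C (Suc k) * C m) = (2 * (2 * k + 1) * Suc m) * (C k * C m)"
    using S[of k] by (metis (no_types, opaque_lifting) mult.assoc mult.commute)
  also have "\<dots> < (2 * (2 * m + 1) * Suc k) * (C k * C m)"
    using pos assms by (intro mult_strict_right_mono) (auto simp: algebra_simps)
  also have "\<dots> = Suc m * Suc k * (C k * C (Suc m))"
    using S[of m] by (metis (no_types, opaque_lifting) mult.assoc mult.commute)
  finally have "C (Suc k) * C m < C k * C (Suc m)" by (simp only: mult_less_cancel1)
  then show ?thesis by (simp only: C_def)
qed

lemma central_binomial_product_decreasing:
  assumes "j < k" "2 * k \<le> p"
  shows "((2 * k) choose k) * ((2 * (p - k)) choose (p - k))
    < ((2 * j) choose j) * ((2 * (p - j)) choose (p - j))"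
  using assms
proof (induction k)
  case (Suc k)
  have eq: "p - k = Suc (p - Suc k)" using Suc.prems by simp
  have "((2 * Suc k) choose Suc k) * ((2 * (p - Suc k)) choose (p - Suc k))
      < ((2 * k) choose k) * ((2 * (p - k)) choose (p - k))"
    unfolding eq using Suc.prems by (intro central_binomial_log_convex) simp
  moreover have "\<dots> \<le> ((2 * j) choose j) * ((2 * (p - j)) choose (p - j))"
    using Suc by (cases "j = k") (auto intro: less_imp_le)
  ultimately show ?case by simp
qed simp

text \<open>
  With \<open>d = 2 * k\<close>, the number of common neighbours is a product that is symmetric under
  \<open>k \<mapsto> p - k\<close> and strictly decreasing up to the middle \<open>p / 2\<close>, hence injective on folded distances. It
  is zero precisely at odd distances.
\<close>

lemma fdist_eq_if_card_common_nbrs_eq: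
  fixes S T S' T' :: "'a::finite set"
  assumes N: "CARD('a) = 2 * p" and ev: "even (sdist S T)"
    and eq: "card (common_nbrs p S T) = card (common_nbrs p S' T')"
  shows "even (sdist S' T')" and "fdist S T = fdist S' T'"
proof -
  define F where "F k = ((2 * k) choose k) * ((2 * (p - k)) choose (p - k))" for k
  have F: "card (common_nbrs p A B) = F (fdist A B div 2)" "even (fdist A B)" "fdist A B \<le> p"
    if ev: "even (sdist A B)" for A B :: "'a set"
  proof -
    obtain k where k: "sdist A B = 2 * k" using ev by blast
    have "k \<le> p" using sdist_le_CARD[of A B] by (simp add: N k)
    then have fd: "fdist A B = 2 * k \<or> fdist A B = 2 * (p - k)" and "fdist A B \<le> p"
      by (auto simp: fdist_def N k min_def)
    then show "even (fdist A B)" "fdist A B \<le> p" by auto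
    have "F (p - k) = F k" using \<open>k \<le> p\<close> by (simp add: F_def mult.commute)
    moreover have "card (common_nbrs p A B) = F k"
      using \<open>k \<le> p\<close> by (simp add: card_common_nbrs[OF N] k F_def diff_mult_distrib2)
    ultimately show "card (common_nbrs p A B) = F (fdist A B div 2)" using fd by fastforce
  qed
  have "card (common_nbrs p S' T') \<noteq> 0"
    unfolding eq[symmetric] F(1)[OF ev] by (simp add: F_def)
  then show ev': "even (sdist S' T')" by (simp add: card_common_nbrs[OF N] split: if_splits)
  have dec: "F k < F j" if "j < k" "2 * k \<le> p" for j k
    unfolding F_def by (rule central_binomial_product_decreasing[OF that])
  have Feq: "F (fdist S T div 2) = F (fdist S' T' div 2)" using F(1)[OF ev] F(1)[OF ev'] eq by simp
  have "2 * (fdist S T div 2) \<le> p" "2 * (fdist S' T' div 2) \<le> p"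
    using F(3)[OF ev] F(3)[OF ev'] by auto
  then have "fdist S T div 2 = fdist S' T' div 2"
    using dec[of "fdist S T div 2" "fdist S' T' div 2"] dec[of "fdist S' T' div 2" "fdist S T div 2"] Feq
    by (cases "fdist S T div 2" "fdist S' T' div 2" rule: linorder_cases) simp_all
  then have "2 * (fdist S T div 2) = 2 * (fdist S' T' div 2)" by simp
  then show "fdist S T = fdist S' T'"
    by (simp only: even_two_times_div_two F(2)[OF ev] F(2)[OF ev'])
qed

section \<open>Maps preserving the half distance\<close>

text \<open>
  An injective map of the finite set of edges into itself is onto, so non-edges go to non-edges.
\<close>

lemma p_preserving_iff:
  fixes \<Phi> :: "'a::finite set \<Rightarrow> 'a set"
  assumes inj: "inj \<Phi>" and pres: "\<And>S T. sdist S T = p \<Longrightarrow> sdist (\<Phi> S) (\<Phi> T) = p"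
  shows "sdist (\<Phi> S) (\<Phi> T) = p \<longleftrightarrow> sdist S T = p"
proof
  define G where "G = {(S, T) |S T :: 'a set. sdist S T = p}"
  have "map_prod \<Phi> \<Phi> ` G = G"
  proof (rule endo_inj_surj)
    show "map_prod \<Phi> \<Phi> ` G \<subseteq> G" using pres by (auto simp: G_def)
    show "inj_on (map_prod \<Phi> \<Phi>) G"
      by (rule inj_on_subset[OF prod.inj_map[OF inj inj] subset_UNIV])
  qed simp
  moreover assume "sdist (\<Phi> S) (\<Phi> T) = p"
  then have "(\<Phi> S, \<Phi> T) \<in> G" by (simp add: G_def)
  ultimately have "(\<Phi> S, \<Phi> T) \<in> map_prod \<Phi> \<Phi> ` G" by simp
  then obtain S' T' where "sdist S' T' = p" "\<Phi> S = \<Phi> S'" "\<Phi> T = \<Phi> T'"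
    by (auto simp: G_def)
  then show "sdist S T = p" using inj by (simp add: inj_eq)
qed (rule pres)

text \<open>
  Common neighbours are mapped onto common neighbours, so their number is an invariant.
\<close>

lemma p_preserving_fdist:
  fixes \<Phi> :: "'a::finite set \<Rightarrow> 'a set"
  assumes N: "CARD('a) = 2 * p" and inj: "inj \<Phi>"
    and pres: "\<And>S T. sdist S T = p \<Longrightarrow> sdist (\<Phi> S) (\<Phi> T) = p"
  shows "even (sdist (\<Phi> S) (\<Phi> T)) \<longleftrightarrow> even (sdist S T)"
    and "even (sdist S T) \<Longrightarrow> fdist (\<Phi> S) (\<Phi> T) = fdist S T"
proof -
  have "surj \<Phi>" using inj by (simp add: finite_UNIV_inj_surj)
  have "\<Phi> ` common_nbrs p S T = common_nbrs p (\<Phi> S) (\<Phi> T)"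
  proof
    show "common_nbrs p (\<Phi> S) (\<Phi> T) \<subseteq> \<Phi> ` common_nbrs p S T"
    proof
      fix Z assume Z: "Z \<in> common_nbrs p (\<Phi> S) (\<Phi> T)"
      obtain Y where "Z = \<Phi> Y" using \<open>surj \<Phi>\<close> by blast
      with Z show "Z \<in> \<Phi> ` common_nbrs p S T"
        using p_preserving_iff[OF inj pres] by (auto simp: common_nbrs_def)
    qed
  qed (auto simp: common_nbrs_def pres)
  then have eq: "card (common_nbrs p S T) = card (common_nbrs p (\<Phi> S) (\<Phi> T))"
    using card_image[OF inj_on_subset[OF inj subset_UNIV], of "common_nbrs p S T"] by simp
  show "even (sdist (\<Phi> S) (\<Phi> T)) \<longleftrightarrow> even (sdist S T)"
  proof
    show "even (sdist S T)" if "even (sdist (\<Phi> S) (\<Phi> T))"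
      by (rule fdist_eq_if_card_common_nbrs_eq(1)[OF N that eq[symmetric]])
    show "even (sdist (\<Phi> S) (\<Phi> T))" if "even (sdist S T)"
      by (rule fdist_eq_if_card_common_nbrs_eq(1)[OF N that eq])
  qed
  show "fdist (\<Phi> S) (\<Phi> T) = fdist S T" if "even (sdist S T)"
    using fdist_eq_if_card_common_nbrs_eq(2)[OF N that eq] by simp
qed

section \<open>Even sets are determined by their distances to pairs\<close>

text \<open>
  A representative of least size in the class of \<open>A\<close> under complementation.
\<close>

definition smaller_half :: "'a::finite set \<Rightarrow> 'a set" where
  "smaller_half A = (if 2 * card A \<le> CARD('a) then A else - A)"

lemma smaller_half_cases: "smaller_half A = A \<or> smaller_half A = - A"
  by (simp add: smaller_half_def)

lemma fdist_smaller_half [simp]: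
  "fdist (smaller_half A) B = fdist A B" "fdist A (smaller_half B) = fdist A B"
  by (simp_all add: smaller_half_def)

lemma card_smaller_half: "card (smaller_half A) = fdist A {}"
  by (auto simp: smaller_half_def fdist_def Compl_eq_Diff_UNIV card_Diff_subset)

text \<open>
  For \<open>i\<close>, \<open>j\<close> in \<open>S\<close> the distance of \<open>S\<close> to \<open>{i, j}\<close> is \<open>card S - 2\<close>. As \<open>S\<close> has at most half of the
  points, this is not equivalent to \<open>card S\<close> under folding, so \<open>\<pi> i\<close> and \<open>\<pi> j\<close> lie on the same side of \<open>T\<close>.
  Hence all of \<open>\<pi> ` S\<close> is on one side, and counting gives equality; the outer side only occurs when \<open>S\<close> has
  exactly half of the points. A singleton \<open>S\<close> would provide no pair, whence the assumption that the
  size is even.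
\<close>

lemma image_perm_if_fdist_pairs:
  fixes S T :: "'a::finite set"
  assumes bij: "bij \<pi>" and card: "card T = card S" and ev: "even (card S)"
    and half: "2 * card S \<le> CARD('a)"
    and pairs: "\<And>i j. i \<in> S \<Longrightarrow> j \<in> S \<Longrightarrow> i \<noteq> j \<Longrightarrow> fdist T {\<pi> i, \<pi> j} = fdist S {i, j}"
  shows "T = \<pi> ` S \<or> T = - \<pi> ` S"
proof (cases "S = {}")
  case True
  then show ?thesis using card by simp
next
  case False
  then obtain i where i: "i \<in> S" by blast
  have cS: "card (\<pi> ` S) = card S"
    by (rule card_image[OF inj_on_subset[OF bij_is_inj[OF bij] subset_UNIV]])
  have "\<not> S \<subseteq> {i}" using i ev by (auto simp: subset_singleton_iff)
  then obtain j where j: "j \<in> S" "j \<noteq> i" by blast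
  have ne: "\<pi> k \<noteq> \<pi> l" if "k \<noteq> l" for k l using bij that by (simp add: bij_is_inj inj_eq)
  have same: "\<pi> k \<in> T \<longleftrightarrow> \<pi> i \<in> T" if "k \<in> S" for k
  proof (rule ccontr)
    assume neq: "(\<pi> k \<in> T) \<noteq> (\<pi> i \<in> T)"
    then have "k \<noteq> i" by auto
    then have "sdist T {\<pi> k, \<pi> i} = card S" "sdist S {k, i} + 2 = card S"
      using sdist_pair(3)[OF ne neq] sdist_pair(1)[OF \<open>k \<noteq> i\<close> that i] card by auto
    then show False using pairs[OF that i \<open>k \<noteq> i\<close>] half by (simp add: fdist_eq_iff)
  qed
  show ?thesis
  proof (cases "\<pi> i \<in> T")
    case True
    then have "\<pi> ` S \<subseteq> T" using same by blast
    then have "\<pi> ` S = T" using card cS by (intro card_subset_eq) auto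
    then show ?thesis by simp
  next
    case False
    then have sub: "\<pi> ` S \<subseteq> - T" using same by blast
    have "\<pi> j \<notin> T" using False same[OF j(1)] by blast
    then have "sdist T {\<pi> i, \<pi> j} = card S + 2"
      using sdist_pair(2)[OF ne[OF j(2)[symmetric]] False] card by simp
    moreover have "sdist S {i, j} + 2 = card S"
      by (rule sdist_pair(1)[OF j(2)[symmetric] i j(1)])
    ultimately have "2 * card S = CARD('a)"
      using pairs[OF i j(1)] j(2) half by (simp add: fdist_eq_iff)
    then have "card (- T) = card S" using card by (simp add: Compl_eq_Diff_UNIV card_Diff_subset)
    then have "\<pi> ` S = - T" using sub cS by (intro card_subset_eq) auto
    then show ?thesis by auto
  qed
qed

text \<open>
  Folded distances only depend on classes, so \<open>S\<close> and \<open>\<Phi> S\<close> may be replaced by representatives of least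
  size. These are equally large because \<open>\<Phi>\<close> fixes the empty set.
\<close>

lemma even_sets_if_pairs:
  fixes \<Phi> :: "'a::finite set \<Rightarrow> 'a set"
  assumes N: "even CARD('a)" and bij: "bij \<pi>" and empty: "\<Phi> {} = {}"
    and fd: "\<And>S T. even (card S) \<Longrightarrow> even (card T) \<Longrightarrow> fdist (\<Phi> S) (\<Phi> T) = fdist S T"
    and pairs: "\<And>i j. i \<noteq> j \<Longrightarrow> \<Phi> {i, j} = {\<pi> i, \<pi> j} \<or> \<Phi> {i, j} = - {\<pi> i, \<pi> j}"
    and ev: "even (card S)"
  shows "\<Phi> S = \<pi> ` S \<or> \<Phi> S = - \<pi> ` S"
proof -
  have "card (smaller_half (\<Phi> S)) = card (smaller_half S)"
    using fd[OF ev, of "{}"] empty by (simp add: card_smaller_half)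
  moreover have "even (card (smaller_half S))"
    using ev N smaller_half_cases[of S] card_mono[of UNIV S]
    by (auto simp: Compl_eq_Diff_UNIV card_Diff_subset)
  moreover have "2 * card (smaller_half S) \<le> CARD('a)" by (simp add: card_smaller_half fdist_def)
  moreover have "fdist (smaller_half (\<Phi> S)) {\<pi> i, \<pi> j} = fdist (smaller_half S) {i, j}"
    if "i \<noteq> j" for i j
  proof -
    have "fdist (\<Phi> S) {\<pi> i, \<pi> j} = fdist (\<Phi> S) (\<Phi> {i, j})"
      using pairs[OF that] by (elim disjE) simp_all
    also have "\<dots> = fdist S {i, j}" using fd[OF ev, of "{i, j}"] that by simp
    finally show ?thesis by simp
  qed
  ultimately have "smaller_half (\<Phi> S) = \<pi> ` smaller_half S
      \<or> smaller_half (\<Phi> S) = - \<pi> ` smaller_half S"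
    by (intro image_perm_if_fdist_pairs[OF bij]) auto
  then show ?thesis
    using smaller_half_cases[of "\<Phi> S"] smaller_half_cases[of S]
    by (metis bij_image_Compl_eq[OF bij] double_complement)
qed

section \<open>The permutation of the positions\<close>

text \<open>
  A pairwise intersecting family of pairs without a common point consists of the sides of a triangle,
  so it has at most three members.
\<close>

lemma common_point_if_pairwise_intersecting:
  assumes two: "\<And>A. A \<in> F \<Longrightarrow> card A = 2"
    and meet: "\<And>A B. A \<in> F \<Longrightarrow> B \<in> F \<Longrightarrow> A \<inter> B \<noteq> {}"
    and big: "card F > 3"
  shows "\<exists>a. \<forall>A\<in>F. a \<in> A"
proof (rule ccontr)
  assume no: "\<not> ?thesis"
  obtain A where A: "A \<in> F" using big by fastforce
  obtain a b where ab: "A = {a, b}" "a \<noteq> b" using two[OF A] by (auto simp: card_2_iff)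
  obtain C where C: "C \<in> F" "a \<notin> C" using no by blast
  obtain c where c: "C = {b, c}" "c \<noteq> b" "c \<noteq> a"
    using two[OF C(1)] meet[OF A C(1)] C(2) ab by (auto simp: card_2_iff)
  obtain B where B: "B \<in> F" "b \<notin> B" using no by blast
  have Bac: "B = {a, c}"
    using two[OF B(1)] meet[OF A B(1)] meet[OF C(1) B(1)] B(2) ab c by (auto simp: card_2_iff)
  have "F \<subseteq> {A, B, C}"
  proof
    fix D assume D: "D \<in> F"
    show "D \<in> {A, B, C}"
      using two[OF D] meet[OF A D] meet[OF B(1) D] meet[OF C(1) D] ab c Bac
      by (auto simp: card_2_iff)
  qed
  then have "card F \<le> card {A, B, C}" by (intro card_mono) auto
  also have "\<dots> \<le> 3" by (simp add: card_insert_if)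
  finally show False using big by simp
qed

text \<open>
  The pairs through \<open>i\<close> are mapped to at least four pairwise intersecting pairs, and \<open>\<pi> i\<close> is their
  common point. If \<open>\<pi> i = \<pi> j\<close> for \<open>i \<noteq> j\<close>, then two disjoint pairs \<open>{i, k}\<close> and \<open>{j, l}\<close> would have
  intersecting images.
\<close>

lemma perm_on_pairs:
  fixes q :: "'a::finite set \<Rightarrow> 'a set"
  assumes big: "CARD('a) > 4"
    and two: "\<And>P. card P = 2 \<Longrightarrow> card (q P) = 2"
    and sd: "\<And>P Q. card P = 2 \<Longrightarrow> card Q = 2 \<Longrightarrow> sdist (q P) (q Q) = sdist P Q"
  shows "\<exists>\<pi>. bij \<pi> \<and> (\<forall>i j. i \<noteq> j \<longrightarrow> q {i, j} = {\<pi> i, \<pi> j})"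
proof -
  have meet: "card (q P \<inter> q Q) = card (P \<inter> Q)" if "card P = 2" "card Q = 2" for P Q
    using card_eq_sdist[of P Q] card_eq_sdist[of "q P" "q Q"] sd[OF that] two that by simp
  have "\<exists>a. \<forall>j. j \<noteq> i \<longrightarrow> a \<in> q {i, j}" for i
  proof -
    let ?F = "(\<lambda>j. q {i, j}) ` (- {i})"
    have "inj_on (\<lambda>j. q {i, j}) (- {i})"
    proof (rule inj_onI)
      fix j k assume jk: "j \<in> - {i}" "k \<in> - {i}" "q {i, j} = q {i, k}"
      then have "sdist {i, j} {i, k} = 0" using sd[of "{i, j}" "{i, k}"] by auto
      then show "j = k" using jk by (auto simp: sdist_eq_0_iff doubleton_eq_iff)
    qed
    then have "card ?F = CARD('a) - 1" by (simp add: card_image Compl_eq_Diff_UNIV)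
    moreover have "card B = 2" if B: "B \<in> ?F" for B
    proof -
      obtain j where "j \<noteq> i" "B = q {i, j}" using B by blast
      then show ?thesis using two[of "{i, j}"] by simp
    qed
    moreover have "B \<inter> C \<noteq> {}" if BC: "B \<in> ?F" "C \<in> ?F" for B C
    proof -
      obtain j k where jk: "j \<noteq> i" "k \<noteq> i" "B = q {i, j}" "C = q {i, k}" using BC by blast
      have "card (B \<inter> C) = card ({i, j} \<inter> {i, k})" using meet[of "{i, j}" "{i, k}"] jk by simp
      also have "\<dots> \<noteq> 0" by simp
      finally show ?thesis by auto
    qed
    ultimately have "\<exists>a. \<forall>B\<in>?F. a \<in> B" using big by (intro common_point_if_pairwise_intersecting) auto
    then show ?thesis by auto
  qed
  then obtain \<pi> where pi: "\<And>i j. j \<noteq> i \<Longrightarrow> \<pi> i \<in> q {i, j}" by metis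
  have "inj \<pi>"
  proof (rule injI, rule ccontr)
    fix i j assume eq: "\<pi> i = \<pi> j" and "i \<noteq> j"
    have more: "\<exists>k. k \<notin> A" if "card A \<le> 3" for A :: "'a set"
      using that big by (cases "A = UNIV") auto
    have three: "card {x, y, z} \<le> 3" for x y z :: 'a by (simp add: card_insert_if)
    obtain k where k: "k \<notin> {i, j, j}" using more[OF three] by blast
    obtain l where l: "l \<notin> {i, j, k}" using more[OF three] by blast
    have "card (q {i, k} \<inter> q {j, l}) = card ({i, k} \<inter> {j, l})"
      using k l by (intro meet) auto
    also have "{i, k} \<inter> {j, l} = {}" using k l \<open>i \<noteq> j\<close> by auto
    finally show False using pi[of k i] pi[of l j] k l eq by auto
  qed
  moreover have "q {i, j} = {\<pi> i, \<pi> j}" if "i \<noteq> j" for i j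
  proof -
    have "{\<pi> i, \<pi> j} \<subseteq> q {i, j}" using pi[of j i] pi[of i j] that by (auto simp: insert_commute)
    moreover have "card {\<pi> i, \<pi> j} = 2" using inj_eq[OF \<open>inj \<pi>\<close>, of i j] that by simp
    ultimately show ?thesis using two[of "{i, j}"] that by (metis card_2_iff card_subset_eq finite)
  qed
  ultimately show ?thesis by (auto simp: bij_def finite_UNIV_inj_surj)
qed

text \<open>
  Two pairs have distance at most \<open>4\<close>. If \<open>CARD('a) \<ge> 8\<close>, then distances in this range are recovered from
  their folded versions, and the argument on pairs applies.
\<close>

lemma ex_perm_on_even_sets:
  fixes \<Phi> :: "'a::finite set \<Rightarrow> 'a set"
  assumes N: "even CARD('a)" and big: "CARD('a) \<ge> 8" and empty: "\<Phi> {} = {}"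
    and fd: "\<And>S T. even (card S) \<Longrightarrow> even (card T) \<Longrightarrow> fdist (\<Phi> S) (\<Phi> T) = fdist S T"
  shows "\<exists>\<pi>. bij \<pi> \<and> (\<forall>S. even (card S) \<longrightarrow> \<Phi> S = \<pi> ` S \<or> \<Phi> S = - \<pi> ` S)"
proof -
  define q where "q P = smaller_half (\<Phi> P)" for P
  have two: "card (q P) = 2" if "card P = 2" for P
    using fd[of P "{}"] that empty big by (simp add: q_def card_smaller_half fdist_def)
  have "sdist (q P) (q Q) = sdist P Q" if PQ: "card P = 2" "card Q = 2" for P Q
  proof -
    have "fdist (q P) (q Q) = fdist P Q" using fd[of P Q] PQ by (simp add: q_def)
    then have "sdist (q P) (q Q) = sdist P Q \<or> sdist (q P) (q Q) + sdist P Q = CARD('a)"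
      by (simp only: fdist_eq_iff)
    moreover have "sdist P Q \<le> 4" "sdist (q P) (q Q) \<le> 4"
      using card_eq_sdist[of P Q] card_eq_sdist[of "q P" "q Q"] two[OF PQ(1)] two[OF PQ(2)] PQ
      by linarith+
    ultimately show ?thesis using big by linarith
  qed
  then obtain \<pi> where bij: "bij \<pi>" and pi: "\<And>i j. i \<noteq> j \<Longrightarrow> q {i, j} = {\<pi> i, \<pi> j}"
    using perm_on_pairs[of q] two big by auto
  have "\<Phi> {i, j} = {\<pi> i, \<pi> j} \<or> \<Phi> {i, j} = - {\<pi> i, \<pi> j}" if "i \<noteq> j" for i j
    using pi[OF that] smaller_half_cases[of "\<Phi> {i, j}"] by (auto simp: q_def)
  then show ?thesis using even_sets_if_pairs[OF N bij empty fd] bij by blast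
qed

text \<open>
  For six points the pairs are pairwise at folded distance \<open>2\<close> and carry no information. When odd
  distances are preserved too, the singletons, at folded distance \<open>1\<close> from the empty set, are permuted,
  and \<open>{i, j}\<close> is recovered as the class of folded size \<open>2\<close> at folded distance \<open>1\<close> from both \<open>{i}\<close> and
  \<open>{j}\<close>.
\<close>

lemma ex_perm_on_even_sets_6:
  fixes \<Phi> :: "'a::finite set \<Rightarrow> 'a set"
  assumes N: "CARD('a) = 6" and empty: "\<Phi> {} = {}"
    and fd: "\<And>S T. fdist (\<Phi> S) (\<Phi> T) = fdist S T"
  shows "\<exists>\<pi>. bij \<pi> \<and> (\<forall>S. even (card S) \<longrightarrow> \<Phi> S = \<pi> ` S \<or> \<Phi> S = - \<pi> ` S)"
proof -
  have card_q: "card (smaller_half (\<Phi> P)) = card P" if "card P \<le> 3" for P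
    using fd[of P "{}"] that empty N by (simp add: card_smaller_half fdist_def)
  then have "\<exists>a. smaller_half (\<Phi> {i}) = {a}" for i by (simp add: card_1_singleton_iff[symmetric])
  then obtain \<pi> where pi: "\<And>i. smaller_half (\<Phi> {i}) = {\<pi> i}" by metis
  have sing: "fdist {\<pi> i} (smaller_half (\<Phi> S)) = fdist {i} S" for i S
    using fd[of "{i}" S] by (simp add: pi[symmetric])
  have "inj \<pi>"
  proof (rule injI)
    fix i j assume "\<pi> i = \<pi> j"
    then have "fdist {i} {j} = fdist {\<pi> i} {\<pi> i}" using sing[of i "{j}"] by (simp add: pi)
    moreover have "sdist {i} {j} \<le> 2"
      using card_eq_sdist[of "{i}" "{j}"] by simp
    ultimately have "sdist {i} {j} = 0" using N by (simp add: fdist_eq_iff)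
    then show "i = j" by (simp add: sdist_eq_0_iff)
  qed
  then have bij: "bij \<pi>" by (simp add: bij_def finite_UNIV_inj_surj)
  have "\<Phi> {i, j} = {\<pi> i, \<pi> j} \<or> \<Phi> {i, j} = - {\<pi> i, \<pi> j}" if "i \<noteq> j" for i j
  proof -
    let ?T = "smaller_half (\<Phi> {i, j})"
    have T: "card ?T = 2" using card_q[of "{i, j}"] that by simp
    have in_T: "\<pi> k \<in> ?T" if "k \<in> {i, j}" for k
    proof (rule ccontr)
      assume "\<pi> k \<notin> ?T"
      then have "sdist {\<pi> k} ?T = 3" using card_eq_sdist[of "{\<pi> k}" ?T] T by simp
      moreover have "sdist {k} {i, j} = 1"
        using card_eq_sdist[of "{k}" "{i, j}"] \<open>i \<noteq> j\<close> that by auto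
      ultimately show False using sing[of k "{i, j}"] N unfolding fdist_eq_iff by simp
    qed
    have "card {\<pi> i, \<pi> j} = 2" using inj_eq[OF \<open>inj \<pi>\<close>, of i j] that by simp
    moreover have "{\<pi> i, \<pi> j} \<subseteq> ?T" using in_T by simp
    ultimately have "?T = {\<pi> i, \<pi> j}" using T by (metis card_subset_eq finite)
    then show ?thesis using smaller_half_cases[of "\<Phi> {i, j}"] by auto
  qed
  then show ?thesis using even_sets_if_pairs[of \<pi> \<Phi>] bij empty fd N by auto
qed

text \<open>
  The even sets are known by the previous lemmas: for \<open>p = 3\<close> the folded distance of two sets of different
  parity is \<open>1\<close> or \<open>3\<close>, and the second value is the one preserved by assumption. Every neighbour of an odd set \<open>S\<close>
  is even because \<open>p\<close> is odd, so the neighbours of \<open>\<pi> ` S\<close> are also neighbours of \<open>\<Phi> S\<close>. The number of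
  common neighbours of these two sets is then maximal, which makes their folded distance zero.
\<close>

lemma ex_perm_if_p_odd:
  fixes \<Phi> :: "'a::finite set \<Rightarrow> 'a set"
  assumes N: "CARD('a) = 2 * p" and p: "odd p" "p \<noteq> 1" and empty: "\<Phi> {} = {}"
    and inj: "inj \<Phi>" and pres: "\<And>S T. sdist S T = p \<Longrightarrow> sdist (\<Phi> S) (\<Phi> T) = p"
  shows "\<exists>\<pi>. bij \<pi> \<and> (\<forall>S. \<Phi> S = \<pi> ` S \<or> \<Phi> S = - \<pi> ` S)"
proof -
  have parity: "even (sdist (\<Phi> S) (\<Phi> T)) \<longleftrightarrow> even (sdist S T)" for S T
    by (rule p_preserving_fdist(1)[OF N inj pres])
  have fd: "fdist (\<Phi> S) (\<Phi> T) = fdist S T" if "even (sdist S T)" for S T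
    by (rule p_preserving_fdist(2)[OF N inj pres that])
  have "\<exists>\<pi>. bij \<pi> \<and> (\<forall>S. even (card S) \<longrightarrow> \<Phi> S = \<pi> ` S \<or> \<Phi> S = - \<pi> ` S)"
  proof (cases "p = 3")
    case True
    then have N6: "CARD('a) = 6" using N by simp
    have "fdist (\<Phi> S) (\<Phi> T) = fdist S T" for S T
    proof (cases "even (sdist S T)")
      case False
      have "sdist A B \<in> {1, 3, 5}" if "odd (sdist A B)" for A B :: "'a set"
        using sdist_le_CARD[of A B] that N6 by simp presburger
      then have "sdist S T \<in> {1, 3, 5}" "sdist (\<Phi> S) (\<Phi> T) \<in> {1, 3, 5}" using False parity by auto
      moreover have "sdist (\<Phi> S) (\<Phi> T) = 3 \<longleftrightarrow> sdist S T = 3"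
        using p_preserving_iff[OF inj pres] True by simp
      ultimately show ?thesis by (auto simp: fdist_eq_iff N6)
    qed (rule fd)
    then show ?thesis by (rule ex_perm_on_even_sets_6[of \<Phi>, OF N6 empty])
  next
    case False
    then have "CARD('a) \<ge> 8" using N p by presburger
    then show ?thesis using N empty fd by (intro ex_perm_on_even_sets) (auto simp: even_sdist_iff)
  qed
  then obtain \<pi> where bij: "bij \<pi>"
    and pi: "\<And>S. even (card S) \<Longrightarrow> \<Phi> S = \<pi> ` S \<or> \<Phi> S = - \<pi> ` S" by blast
  have "\<Phi> S = \<pi> ` S \<or> \<Phi> S = - \<pi> ` S" if odd: "odd (card S)" for S
  proof -
    have "common_nbrs p (\<pi> ` S) (\<pi> ` S) \<subseteq> common_nbrs p (\<Phi> S) (\<pi> ` S)"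
    proof
      fix W assume W: "W \<in> common_nbrs p (\<pi> ` S) (\<pi> ` S)"
      obtain Z where Z: "W = \<pi> ` Z" using bij by (metis bij_def image_f_inv_f surj_def surj_image_vimage_eq)
      have d: "sdist S Z = p" using W bij by (simp add: Z common_nbrs_def sdist_image bij_is_inj)
      then have "even (card Z)" using odd p(1) even_sdist_iff[of S Z] by simp
      then have "sdist (\<Phi> S) (\<pi> ` Z) = p"
      proof -
        have "p = sdist (\<Phi> S) (\<pi> ` Z) \<or> p = 2 * p - sdist (\<Phi> S) (\<pi> ` Z)"
          using pi[OF \<open>even (card Z)\<close>] pres[OF d] sdist_Compl_right[of "\<Phi> S" "\<pi> ` Z"] N by metis
        then show ?thesis using odd_pos[OF p(1)] by linarith
      qed
      then show "W \<in> common_nbrs p (\<Phi> S) (\<pi> ` S)"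
        using W by (simp add: Z common_nbrs_def)
    qed
    moreover have "common_nbrs p (\<Phi> S) (\<pi> ` S) \<subseteq> common_nbrs p (\<pi> ` S) (\<pi> ` S)"
      by (auto simp: common_nbrs_def)
    ultimately have "card (common_nbrs p (\<pi> ` S) (\<pi> ` S)) = card (common_nbrs p (\<Phi> S) (\<pi> ` S))"
      by simp
    from fdist_eq_if_card_common_nbrs_eq(2)[OF N _ this]
    have "sdist (\<Phi> S) (\<pi> ` S) = 0 \<or> sdist (\<Phi> S) (\<pi> ` S) = CARD('a)"
      by (simp add: fdist_eq_iff)
    then have "sdist (\<Phi> S) (\<pi> ` S) = 0 \<or> sdist (\<Phi> S) (- \<pi> ` S) = 0"
      by (auto simp: sdist_Compl_right)
    then show ?thesis by (auto simp: sdist_eq_0_iff)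
  qed
  with pi bij show ?thesis by metis
qed

section \<open>Words as sets up to complement\<close>

text \<open>
  The position \<open>None\<close> is kept at zero: a set that contains it is complemented before its indicator
  is read off.
\<close>

definition word_of :: "'n::finite option set \<Rightarrow> 'n word" where
  "word_of S = (\<chi> k. if Some k \<in> S \<longleftrightarrow> None \<in> S then 0 else 1)"

definition set_of :: "'n::finite word \<Rightarrow> 'n option set" where
  "set_of c = Some ` {k. c $ k = 1}"

lemma Some_in_set_of [simp]: "Some k \<in> set_of c \<longleftrightarrow> c $ k = 1"
  by (auto simp: set_of_def)

lemma None_notin_set_of [simp]: "None \<notin> set_of c"
  by (auto simp: set_of_def)

lemma word_of_nth: "word_of S $ k = (if Some k \<in> S \<longleftrightarrow> None \<in> S then 0 else 1)"
  by (simp add: word_of_def)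

lemma word_of_set_of [simp]: "word_of (set_of c) = c"
  by (simp add: vec_eq_iff word_of_nth)

text \<open>
  Finiteness is inherited from the sets, since every word is represented by one.
\<close>

lemma finite_words: "finite (UNIV :: 'n::finite word set)"
proof -
  have "surj (word_of :: 'n option set \<Rightarrow> 'n word)" by (rule surjI) (rule word_of_set_of)
  then show ?thesis by (metis finite finite_imageI)
qed

lemma bij_if_inj_on_words: "inj f \<Longrightarrow> bij f" for f :: "'n::finite word \<Rightarrow> 'n word"
  by (simp add: bij_def finite_UNIV_inj_surj[OF finite_words])

lemma set_of_word_of: "set_of (word_of S) = (if None \<in> S then - S else S)"
proof -
  have "x \<in> set_of (word_of S) \<longleftrightarrow> x \<in> (if None \<in> S then - S else S)" for x
    by (cases x) (auto simp: word_of_nth)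
  then show ?thesis by blast
qed

lemma word_of_eq_iff: "word_of S = word_of T \<longleftrightarrow> S = T \<or> S = - T"
proof
  assume "word_of S = word_of T"
  then have "set_of (word_of S) = set_of (word_of T)" by simp
  then show "S = T \<or> S = - T" by (auto simp: set_of_word_of split: if_splits)
qed (auto simp: vec_eq_iff word_of_nth)

lemma word_of_Compl [simp]: "word_of (- S) = word_of S"
  by (simp add: word_of_eq_iff)

text \<open>
  Complementation is the symmetric difference with the full set, whose word is \<open>0\<close>. Passing to
  complements therefore does not disturb additivity.
\<close>

lemma word_of_sym_diff: "word_of (sym_diff S T) = word_of S + word_of T"
  by (auto simp: vec_eq_iff word_of_nth)

lemma set_of_0 [simp]: "set_of 0 = {}"
  by (simp add: set_of_def)

lemma set_of_add: "set_of (x + y) = sym_diff (set_of x) (set_of y)"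
  using set_of_word_of[of "sym_diff (set_of x) (set_of y)"] by (simp add: word_of_sym_diff)

lemma word_add_self [simp]: "x + x = 0" for x :: "'n::finite word"
  by (simp add: vec_eq_iff)

lemma word_add_cancel [simp]: "x + y + y = x" for x y :: "'n::finite word"
  by (simp add: add.assoc)

lemma weight_eq_card: "weight c = card (set_of c)"
  by (simp add: weight_def set_of_def card_image)

lemma hdist_eq_sdist: "hdist x y = sdist (set_of x) (set_of y)"
proof -
  have "{k. x $ k \<noteq> y $ k} = {k. (x + y) $ k = 1}"
    by auto
  then have "hdist x y = card (set_of (x + y))"
    by (simp add: hdist_def set_of_def card_image)
  then show ?thesis by (simp add: set_of_add sdist_def)
qed

lemma hdist_eq_weight: "hdist x y = weight (x + y)"
  by (simp add: hdist_eq_sdist weight_eq_card set_of_add sdist_def)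

lemma even_weight_add_iff: "even (weight (x + y)) \<longleftrightarrow> (even (weight x) \<longleftrightarrow> even (weight y))"
  using even_sdist_iff[of "set_of x" "set_of y"]
  by (simp add: weight_eq_card set_of_add sdist_def)

lemma hdist_word_of:
  fixes S T :: "'n::finite option set"
  shows "hdist (word_of S) (word_of T) =
    (if None \<in> S \<longleftrightarrow> None \<in> T then sdist S T else CARD('n option) - sdist S T)"
  using sdist_le_CARD[of S T]
  by (simp add: hdist_eq_sdist set_of_word_of sdist_Compl_left sdist_Compl_right)

text \<open>
  Half of the length is the distance that folding leaves unchanged, so here the choice of
  representatives does not matter.
\<close>

lemma hdist_word_of_eq_half_iff:
  fixes S T :: "'n::finite option set"
  assumes "CARD('n option) = 2 * p"
  shows "hdist (word_of S) (word_of T) = p \<longleftrightarrow> sdist S T = p"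
  using assms sdist_le_CARD[of S T] by (auto simp: hdist_word_of)

section \<open>Permutations of the extended positions\<close>

text \<open>
  A permutation commutes with complementation, so another representative of \<open>c\<close> would give the same
  word.
\<close>

definition perm_word :: "('n option \<Rightarrow> 'n option) \<Rightarrow> 'n::finite word \<Rightarrow> 'n word" where
  "perm_word \<pi> c = word_of (\<pi> ` set_of c)"

lemma perm_word_add:
  assumes "bij \<pi>" shows "perm_word \<pi> (x + y) = perm_word \<pi> x + perm_word \<pi> y"
  using bij_is_inj[OF assms]
  by (simp add: perm_word_def set_of_add image_Un image_set_diff word_of_sym_diff)

lemma bij_perm_word:
  assumes bij: "bij \<pi>" shows "bij (perm_word \<pi>)"
proof -
  have "inj (perm_word \<pi>)"
  proof (rule injI)
    fix x y assume "perm_word \<pi> x = perm_word \<pi> y"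
    then have "\<pi> ` set_of x = \<pi> ` set_of y \<or> \<pi> ` set_of x = \<pi> ` (- set_of y)"
      by (simp add: perm_word_def word_of_eq_iff bij_image_Compl_eq[OF bij])
    then have "set_of x = set_of y \<or> set_of x = - set_of y"
      by (simp add: inj_image_eq_iff bij_is_inj[OF bij])
    then have "word_of (set_of x) = word_of (set_of y)" by (simp only: word_of_eq_iff)
    then show "x = y" by simp
  qed
  then show ?thesis by (rule bij_if_inj_on_words)
qed

lemma perm_word_half:
  fixes \<pi> :: "'n::finite option \<Rightarrow> 'n option"
  assumes N: "CARD('n option) = 2 * p" and bij: "bij \<pi>" and "hdist x y = p"
  shows "hdist (perm_word \<pi> x) (perm_word \<pi> y) = p"
  using assms(3)
  by (simp add: perm_word_def hdist_word_of_eq_half_iff[OF N] sdist_image[OF bij_is_inj[OF bij]]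
      flip: hdist_eq_sdist)

lemma even_weight_perm_word_iff:
  fixes \<pi> :: "'n::finite option \<Rightarrow> 'n option"
  assumes N: "even CARD('n option)" and bij: "bij \<pi>"
  shows "even (weight (perm_word \<pi> x)) \<longleftrightarrow> even (weight x)"
proof -
  have c: "card (\<pi> ` S) = card S" for S
    using card_image[OF inj_on_subset[OF bij_is_inj[OF bij] subset_UNIV]] by blast
  have "card (\<pi> ` set_of x) \<le> CARD('n option)" by (intro card_mono) auto
  then show ?thesis using N
    by (auto simp: perm_word_def weight_eq_card set_of_word_of c Compl_eq_Diff_UNIV card_Diff_subset
        simp del: card_option)
qed

text \<open>
  A permutation fixing \<open>None\<close> maps sets without \<open>None\<close> to such sets, so no complement is ever taken.
\<close>

lemma isometry_perm_word:
  assumes bij: "bij \<pi>" and None: "\<pi> None = None"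
  shows "isometry (perm_word \<pi>)"
proof -
  have "None \<notin> \<pi> ` set_of x" for x
    using None bij_is_inj[OF bij] by (metis None_notin_set_of inj_image_mem_iff)
  then show ?thesis
    using bij_perm_word[OF bij]
    by (simp add: isometry_def perm_word_def hdist_word_of sdist_image[OF bij_is_inj[OF bij]]
        flip: hdist_eq_sdist)
qed

text \<open>
  The image of the set of \<open>c\<close> contains \<open>None\<close> exactly if \<open>c $ i = 1\<close>. In that case the word is read from
  the complement, which accounts for the summand \<open>1\<close> in the definition of a \<open>\<sigma>\<close>-mapping.
\<close>

lemma sigma_map_eq_perm_word:
  assumes \<pi>: "bij \<pi>" and i: "\<pi> (Some i) = None" and j: "\<pi> None = Some j"
    and \<sigma>: "\<And>k. k \<noteq> i \<Longrightarrow> \<pi> (Some k) = Some (\<sigma> k)"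
  shows "bij_betw \<sigma> (- {i}) (- {j})" and "sigma_map i j \<sigma> = perm_word \<pi>"
proof -
  have inj: "inj \<pi>" and surj: "surj \<pi>" using \<pi> by (auto simp: bij_def)
  show bij: "bij_betw \<sigma> (- {i}) (- {j})"
    unfolding bij_betw_def
  proof
    show "inj_on \<sigma> (- {i})"
      by (rule inj_onI) (metis Compl_iff insertI1 \<sigma> injD[OF inj] option.inject)
    show "\<sigma> ` (- {i}) = - {j}"
    proof (intro equalityI subsetI)
      fix k assume "k \<in> - {j}"
      obtain y where y: "\<pi> y = Some k" using surj by (metis surj_def)
      then obtain l where "y = Some l" using j \<open>k \<in> - {j}\<close> by (cases y) auto
      moreover from this have "l \<noteq> i" using i y by auto
      ultimately show "k \<in> \<sigma> ` (- {i})" using \<sigma>[of l] y by auto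
    next
      fix k assume "k \<in> \<sigma> ` (- {i})"
      then obtain l where "l \<noteq> i" "k = \<sigma> l" by auto
      then have "\<pi> (Some l) = Some k" using \<sigma> by simp
      moreover have "\<pi> (Some l) \<noteq> \<pi> None" using inj_eq[OF inj] by simp
      ultimately have "k \<noteq> j" using j by auto
      then show "k \<in> - {j}" by auto
    qed
  qed
  show "sigma_map i j \<sigma> = perm_word \<pi>"
  proof
    fix c
    have None: "None \<in> \<pi> ` set_of c \<longleftrightarrow> c $ i = 1"
      using inj_image_mem_iff[OF inj, of "Some i" "set_of c"] by (simp add: i)
    have j_in: "Some j \<notin> \<pi> ` set_of c"
      using inj_image_mem_iff[OF inj, of None "set_of c"] by (simp add: j)
    have k_in: "Some k \<in> \<pi> ` set_of c \<longleftrightarrow> c $ inv_into (- {i}) \<sigma> k = 1" if "k \<noteq> j" for k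
    proof -
      define l where "l = inv_into (- {i}) \<sigma> k"
      have k: "k \<in> \<sigma> ` (- {i})" using bij that by (simp add: bij_betw_def)
      have "l \<noteq> i" "\<sigma> l = k"
        using inv_into_into[OF k] f_inv_into_f[OF k] by (simp_all add: l_def)
      then have "\<pi> (Some l) = Some k" using \<sigma> by simp
      then show ?thesis using inj_image_mem_iff[OF inj, of "Some l" "set_of c"] by (simp add: l_def)
    qed
    show "sigma_map i j \<sigma> c = perm_word \<pi> c"
      by (auto simp: sigma_map_def perm_word_def vec_eq_iff word_of_nth None j_in k_in)
  qed
qed

text \<open>
  The data \<open>i\<close>, \<open>j\<close>, \<open>\<sigma>\<close> describe a permutation as \<open>Some i \<mapsto> None \<mapsto> Some j\<close> together with \<open>\<sigma>\<close> on the
  remaining positions, and every permutation that moves \<open>None\<close> has this form.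
\<close>

lemma is_sigma_mapping_iff:
  "is_sigma_mapping \<tau> \<longleftrightarrow> (\<exists>\<pi>. bij \<pi> \<and> \<pi> None \<noteq> None \<and> \<tau> = perm_word \<pi>)"
proof
  assume "is_sigma_mapping \<tau>"
  then obtain i j \<sigma> where \<sigma>: "bij_betw \<sigma> (- {i}) (- {j})" and \<tau>: "\<tau> = sigma_map i j \<sigma>"
    by (auto simp: is_sigma_mapping_def)
  define \<pi> where "\<pi> x = (case x of None \<Rightarrow> Some j | Some k \<Rightarrow> if k = i then None else Some (\<sigma> k))" for x
  have \<sigma>j: "\<sigma> k \<noteq> j" if "k \<noteq> i" for k using \<sigma> that by (auto simp: bij_betw_def)
  have \<sigma>_inj: "k = l" if "\<sigma> k = \<sigma> l" "k \<noteq> i" "l \<noteq> i" for k l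
    using inj_onD[OF bij_betw_imp_inj_on[OF \<sigma>] that(1)] that by simp
  have "inj \<pi>"
  proof (rule injI)
    fix x y assume "\<pi> x = \<pi> y"
    then show "x = y"
      using \<sigma>j \<sigma>j[symmetric]
      by (cases x; cases y) (auto simp: \<pi>_def split: if_splits intro: \<sigma>_inj)
  qed
  then have "bij \<pi>" by (simp add: bij_def finite_UNIV_inj_surj)
  moreover have "\<tau> = perm_word \<pi>" unfolding \<tau>
    by (rule sigma_map_eq_perm_word(2)[OF \<open>bij \<pi>\<close>]) (auto simp: \<pi>_def)
  ultimately show "\<exists>\<pi>. bij \<pi> \<and> \<pi> None \<noteq> None \<and> \<tau> = perm_word \<pi>"
    by (intro exI[of _ \<pi>]) (auto simp: \<pi>_def)
next
  assume "\<exists>\<pi>. bij \<pi> \<and> \<pi> None \<noteq> None \<and> \<tau> = perm_word \<pi>"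
  then obtain \<pi> where bij: "bij \<pi>" and "\<pi> None \<noteq> None" and \<tau>: "\<tau> = perm_word \<pi>" by blast
  then obtain j where j: "\<pi> None = Some j" by auto
  obtain x where x: "\<pi> x = None" using bij by (metis bij_def surj_def)
  then obtain i where i: "\<pi> (Some i) = None" using j by (cases x) auto
  have "\<pi> (Some k) = Some (the (\<pi> (Some k)))" if "k \<noteq> i" for k
  proof -
    have "\<pi> (Some k) \<noteq> \<pi> (Some i)" using bij that by (simp add: bij_is_inj inj_eq)
    then show ?thesis using i by auto
  qed
  from sigma_map_eq_perm_word[where \<sigma> = "\<lambda>k. the (\<pi> (Some k))", OF bij i j this] \<tau>
  show "is_sigma_mapping \<tau>" unfolding is_sigma_mapping_def by metis
qed

section \<open>Half-distance isometries of the cube\<close>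

text \<open>
  A lift of \<open>\<phi>\<close> from classes to sets. Of the two representatives of an image class it takes the one that agrees with
  \<open>S\<close> about \<open>None\<close>; this makes the lift injective when \<open>\<phi>\<close> is.
\<close>

definition set_lift :: "('n::finite word \<Rightarrow> 'n word) \<Rightarrow> 'n option set \<Rightarrow> 'n option set" where
  "set_lift \<phi> S = (if None \<in> S then - set_of (\<phi> (word_of S)) else set_of (\<phi> (word_of S)))"

lemma word_of_set_lift: "word_of (set_lift \<phi> S) = \<phi> (word_of S)"
  by (simp add: set_lift_def)

lemma inj_set_lift:
  assumes "inj \<phi>" shows "inj (set_lift \<phi>)"
proof (rule injI)
  fix S T assume eq: "set_lift \<phi> S = set_lift \<phi> T"
  have None: "None \<in> set_lift \<phi> A \<longleftrightarrow> None \<in> A" for A by (simp add: set_lift_def)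
  have "word_of S = word_of T"
    using arg_cong[OF eq, of word_of] assms by (simp add: word_of_set_lift inj_eq)
  moreover have "None \<in> S \<longleftrightarrow> None \<in> T" using None eq by metis
  ultimately show "S = T" by (auto simp: word_of_eq_iff)
qed

lemma set_lift_half:
  fixes \<phi> :: "'n::finite word \<Rightarrow> 'n word"
  assumes N: "CARD('n option) = 2 * p" and p: "p_isometry p \<phi>" and "sdist S T = p"
  shows "sdist (set_lift \<phi> S) (set_lift \<phi> T) = p"
  using assms(3) p
  by (simp add: hdist_word_of_eq_half_iff[OF N, symmetric] word_of_set_lift p_isometry_def)

lemma word_of_empty [simp]: "word_of {} = 0"
  by (simp add: vec_eq_iff word_of_nth)

lemma set_lift_empty: "\<phi> 0 = 0 \<Longrightarrow> set_lift \<phi> {} = {}"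
  by (simp add: set_lift_def)

context
  fixes \<phi> :: "'n::finite word \<Rightarrow> 'n word" and p :: nat
  assumes N: "CARD('n option) = 2 * p" and iso: "p_isometry p \<phi>"
begin

lemma inj_set_lift_if_p_isometry: "inj (set_lift \<phi>)"
  using iso by (intro inj_set_lift) (simp add: p_isometry_def bij_is_inj)

lemma p_isometry_parity: "even (weight (\<phi> x + \<phi> y)) \<longleftrightarrow> even (weight (x + y))"
proof -
  have l: "set_lift \<phi> (set_of z) = set_of (\<phi> z)" for z by (simp add: set_lift_def)
  show ?thesis
    using p_preserving_fdist(1)[OF N inj_set_lift_if_p_isometry set_lift_half[OF N iso], of "set_of x" "set_of y"]
    by (simp add: l hdist_eq_weight[symmetric] hdist_eq_sdist)
qed

lemma p_isometry_eq_perm_word_if_odd: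
  assumes "odd p" "p \<noteq> 1" "\<phi> 0 = 0"
  shows "\<exists>\<pi>. bij \<pi> \<and> \<phi> = perm_word \<pi>"
proof -
  obtain \<pi> where bij: "bij \<pi>" and \<pi>: "\<And>S. set_lift \<phi> S = \<pi> ` S \<or> set_lift \<phi> S = - \<pi> ` S"
    using ex_perm_if_p_odd[OF N assms(1,2) set_lift_empty[of \<phi>, OF assms(3)] inj_set_lift_if_p_isometry set_lift_half[OF N iso]]
    by blast
  have "\<phi> c = perm_word \<pi> c" for c
    using word_of_set_lift[of \<phi> "set_of c"] \<pi>[of "set_of c"] by (auto simp: perm_word_def)
  with bij show ?thesis by blast
qed

lemma p_isometry_eq_perm_word_on_even_words:
  assumes big: "p \<ge> 4" and 0: "\<phi> 0 = 0"
  shows "\<exists>\<pi>. bij \<pi> \<and> (\<forall>c\<in>even_words. \<phi> c = perm_word \<pi> c)"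
proof -
  have "\<exists>\<pi>. bij \<pi> \<and> (\<forall>S. even (card S) \<longrightarrow> set_lift \<phi> S = \<pi> ` S \<or> set_lift \<phi> S = - \<pi> ` S)"
  proof (rule ex_perm_on_even_sets)
    show "fdist (set_lift \<phi> S) (set_lift \<phi> T) = fdist S T" if "even (card S)" "even (card T)" for S T
      using p_preserving_fdist(2)[OF N inj_set_lift_if_p_isometry set_lift_half[OF N iso]] that
      by (simp add: even_sdist_iff)
  qed (use N big set_lift_empty[of \<phi>, OF 0] in auto)
  then obtain \<pi> where bij: "bij \<pi>"
    and \<pi>: "\<And>S. even (card S) \<Longrightarrow> set_lift \<phi> S = \<pi> ` S \<or> set_lift \<phi> S = - \<pi> ` S"
    by blast
  have "\<phi> c = perm_word \<pi> c" if "c \<in> even_words" for c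
    using word_of_set_lift[of \<phi> "set_of c"] \<pi>[of "set_of c"] that
    by (auto simp: perm_word_def even_words_def weight_eq_card)
  with bij show ?thesis by blast
qed

end

lemma hdist_translate: "hdist (x + a) (y + a) = hdist x y"
proof -
  have "(x + a) + (y + a) = (x + y) + (a + a)" by (simp only: ac_simps)
  then show ?thesis by (simp add: hdist_eq_weight)
qed

lemma isometry_translation_comp:
  assumes "isometry \<phi>" shows "isometry (translation a \<circ> \<phi>)"
proof -
  have "inj \<phi>" using assms by (simp add: isometry_def bij_is_inj)
  then have "bij (translation a \<circ> \<phi>)"
    by (intro bij_if_inj_on_words) (simp add: inj_def translation_def)
  then show ?thesis using assms by (simp add: isometry_def translation_def hdist_translate)
qed

text \<open>
  Translating by a word \<open>e\<close> of odd weight before \<open>\<phi>\<close> and by \<open>\<phi> e\<close> after it gives a \<open>p\<close>-isometry \<open>\<psi>\<close> fixing \<open>0\<close>, which is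
  induced by a permutation on the words of even weight. Translating back and using additivity leaves
  the constant \<open>a\<close>.
\<close>

lemma p_isometry_eq_perm_word_on_odd_words:
  fixes \<phi> :: "'n::finite word \<Rightarrow> 'n word"
  assumes N: "CARD('n option) = 2 * p" and iso: "p_isometry p \<phi>" and big: "p \<ge> 4"
    and 0: "\<phi> 0 = 0"
  shows "\<exists>\<pi> a. bij \<pi> \<and> a \<in> even_words \<and> (\<forall>c\<in>odd_words. \<phi> c = perm_word \<pi> c + a)"
proof -
  (* Any word of odd weight would do; this one has weight one. *)
  define e :: "'n word" where "e = word_of {Some undefined}"
  have e: "odd (weight e)" by (simp add: e_def weight_eq_card set_of_word_of)
  have \<phi>e: "odd (weight (\<phi> e))"
    using p_isometry_parity[OF N iso, of e 0] 0 e by simp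
  define \<psi> where "\<psi> c = \<phi> (c + e) + \<phi> e" for c
  have bij: "bij \<phi>" using iso by (simp add: p_isometry_def)
  have "inj \<psi>"
    by (rule injI) (simp add: \<psi>_def bij_is_inj[OF bij, THEN inj_eq])
  moreover have "hdist (\<psi> x) (\<psi> y) = p" if "hdist x y = p" for x y
    using that iso by (simp add: \<psi>_def hdist_translate p_isometry_def)
  ultimately have "p_isometry p \<psi>"
    using iso bij_if_inj_on_words by (simp add: p_isometry_def)
  moreover have "\<psi> 0 = 0" by (simp add: \<psi>_def)
  ultimately obtain \<pi> where \<pi>: "bij \<pi>" and eq: "\<And>c. c \<in> even_words \<Longrightarrow> \<psi> c = perm_word \<pi> c"
    using p_isometry_eq_perm_word_on_even_words[OF N _ big] by blast
  define a where "a = perm_word \<pi> e + \<phi> e"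
  have "even CARD('n option)" using N by simp
  then have "a \<in> even_words"
    using e \<phi>e even_weight_perm_word_iff[OF _ \<pi>]
    by (simp add: even_words_def a_def even_weight_add_iff)
  moreover have "\<phi> c = perm_word \<pi> c + a" if "c \<in> odd_words" for c
  proof -
    have "c + e \<in> even_words"
      using that e by (simp add: odd_words_def even_words_def even_weight_add_iff)
    then have "\<psi> (c + e) = perm_word \<pi> c + perm_word \<pi> e"
      using eq perm_word_add[OF \<pi>] by simp
    then have "\<phi> c + \<phi> e = perm_word \<pi> c + perm_word \<pi> e" by (simp add: \<psi>_def)
    then have "\<phi> c + \<phi> e + \<phi> e = perm_word \<pi> c + a" by (simp only: a_def add.assoc)
    then show ?thesis by simp
  qed
  ultimately show ?thesis using \<pi> by blast
qed

lemma even_isometry_if_isometry: "isometry \<phi> \<Longrightarrow> even_isometry \<phi>"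
  by (simp add: isometry_def even_isometry_def p_isometry_def)

text \<open>
  Words at even distance have weights of the same parity, so the two isometries are never compared
  with each other.
\<close>

lemma even_isometry_if_on_classes:
  assumes "bij \<phi>" "isometry \<alpha>" "isometry \<beta>"
    and "acts_as_on \<phi> \<alpha> even_words" "acts_as_on \<phi> \<beta> odd_words"
  shows "even_isometry \<phi>"
proof -
  have "hdist (\<phi> x) (\<phi> y) = hdist x y" if "even (hdist x y)" for x y
  proof -
    have "x \<in> even_words \<and> y \<in> even_words \<or> x \<in> odd_words \<and> y \<in> odd_words"
      using that by (auto simp: hdist_eq_weight even_weight_add_iff even_words_def odd_words_def)
    then show ?thesis using assms(2-5) by (auto simp: acts_as_on_def isometry_def)
  qed
  then show ?thesis using assms(1) by (auto simp: even_isometry_def p_isometry_def)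
qed

theorem theorem6:
  shows "(CARD('n::finite) mod 4 = 1 \<longrightarrow>
      (\<forall>\<phi> :: 'n word \<Rightarrow> 'n word.
         p_isometry ((CARD('n) + 1) div 2) \<phi> \<and> \<phi> 0 = 0 \<and> \<not> isometry \<phi>
         \<longrightarrow> is_sigma_mapping \<phi>) \<and>
      (\<forall>\<tau> :: 'n word \<Rightarrow> 'n word.
         is_sigma_mapping \<tau> \<longrightarrow> p_isometry ((CARD('n) + 1) div 2) \<tau>))
   \<and> (CARD('n) mod 4 = 3 \<longrightarrow>
      (\<forall>\<phi> :: 'n word \<Rightarrow> 'n word.
         p_isometry ((CARD('n) + 1) div 2) \<phi> \<and> \<phi> 0 = 0 \<and> \<not> even_isometry \<phi>
         \<longrightarrow>
           (\<exists>\<tau> a. is_sigma_mapping \<tau> \<and> a \<in> even_words \<and>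
              acts_as_even_isometry_on \<phi> even_words \<and>
              acts_as_on \<phi> (translation a \<circ> \<tau>) odd_words)
         \<or> (\<exists>\<tau>. is_sigma_mapping \<tau> \<and>
              acts_as_on \<phi> \<tau> even_words \<and>
              acts_as_even_isometry_on \<phi> odd_words)
         \<or> (\<exists>\<tau>1 \<tau>2 a. is_sigma_mapping \<tau>1 \<and> is_sigma_mapping \<tau>2 \<and> a \<in> even_words \<and>
              acts_as_on \<phi> \<tau>1 even_words \<and>
              acts_as_on \<phi> (translation a \<circ> \<tau>2) odd_words)))"
proof (intro conjI impI allI)
  define p where "p = (CARD('n) + 1) div 2"
  {
    assume n: "CARD('n) mod 4 = 1"
    then have N: "CARD('n option) = 2 * p" and p_odd: "odd p" and p: "1 \<le> p" "p \<le> CARD('n)"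
      unfolding p_def card_option by presburger+
    {
      fix \<phi> :: "'n word \<Rightarrow> 'n word"
      assume "p_isometry ((CARD('n) + 1) div 2) \<phi> \<and> \<phi> 0 = 0 \<and> \<not> isometry \<phi>"
      then have iso: "p_isometry p \<phi>" and 0: "\<phi> 0 = 0" and not: "\<not> isometry \<phi>"
        unfolding p_def by simp_all
      (* For p = 1 the cube is a single edge and every bijection is an isometry. *)
      have "p \<noteq> 1"
      proof
        assume "p = 1"
        then have 1: "CARD('n) = 1" using N by simp
        have "hdist x y = (if x = y then 0 else 1)" for x y :: "'n word"
        proof -
          have "hdist x y \<le> CARD('n)" unfolding hdist_def by (intro card_mono) auto
          moreover have "hdist x y = 0 \<longleftrightarrow> x = y" by (simp add: hdist_def vec_eq_iff)
          ultimately show ?thesis using 1 by auto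
        qed
        then have "isometry \<phi>"
          using iso by (simp add: isometry_def p_isometry_def bij_is_inj inj_eq)
        then show False using not by simp
      qed
      then obtain \<pi> where \<pi>: "bij \<pi>" "\<phi> = perm_word \<pi>"
        using p_isometry_eq_perm_word_if_odd[OF N iso p_odd _ 0] by blast
      then have "\<pi> None \<noteq> None" using isometry_perm_word not by blast
      then show "is_sigma_mapping \<phi>" using \<pi> by (auto simp: is_sigma_mapping_iff)
    next
      fix \<tau> :: "'n word \<Rightarrow> 'n word"
      assume "is_sigma_mapping \<tau>"
      then obtain \<pi> where "bij \<pi>" "\<tau> = perm_word \<pi>" by (auto simp: is_sigma_mapping_iff)
      then show "p_isometry ((CARD('n) + 1) div 2) \<tau>"
        using p perm_word_half[OF N] bij_perm_word
        unfolding p_def[symmetric] by (simp add: p_isometry_def)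
    }
  next
    fix \<phi> :: "'n word \<Rightarrow> 'n word"
    assume n: "CARD('n) mod 4 = 3"
      and "p_isometry ((CARD('n) + 1) div 2) \<phi> \<and> \<phi> 0 = 0 \<and> \<not> even_isometry \<phi>"
    then have iso: "p_isometry p \<phi>" and 0: "\<phi> 0 = 0" and not: "\<not> even_isometry \<phi>"
      unfolding p_def by simp_all
    have N: "CARD('n option) = 2 * p" unfolding p_def card_option using n by presburger
    have bij: "bij \<phi>" using iso by (simp add: p_isometry_def)
    (* For n = 3 the only even distance is p = 2 itself. *)
    have "CARD('n) \<noteq> 3"
    proof
      assume 3: "CARD('n) = 3"
      then have "q = p" if "q \<in> {1..CARD('n)}" "even q" for q
        using that by (simp add: p_def) presburger
      then have "even_isometry \<phi>" using iso bij by (auto simp: even_isometry_def)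
      then show False using not by simp
    qed
    then have big: "p \<ge> 4" using n unfolding p_def by presburger
    obtain \<pi>1 where 1: "bij \<pi>1" and even: "acts_as_on \<phi> (perm_word \<pi>1) even_words"
      using p_isometry_eq_perm_word_on_even_words[OF N iso big 0] by (auto simp: acts_as_on_def)
    obtain \<pi>2 a where 2: "bij \<pi>2" and a: "a \<in> even_words"
      and odd: "acts_as_on \<phi> (translation a \<circ> perm_word \<pi>2) odd_words"
      using p_isometry_eq_perm_word_on_odd_words[OF N iso big 0]
      by (auto simp: acts_as_on_def translation_def)
    have \<sigma>: "is_sigma_mapping (perm_word \<pi>)" if "bij \<pi>" "\<pi> None \<noteq> None" for \<pi> :: "'n option \<Rightarrow> _"
      using that by (auto simp: is_sigma_mapping_iff)
    show "(\<exists>\<tau> a. is_sigma_mapping \<tau> \<and> a \<in> even_words \<and>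
              acts_as_even_isometry_on \<phi> even_words \<and>
              acts_as_on \<phi> (translation a \<circ> \<tau>) odd_words)
         \<or> (\<exists>\<tau>. is_sigma_mapping \<tau> \<and>
              acts_as_on \<phi> \<tau> even_words \<and>
              acts_as_even_isometry_on \<phi> odd_words)
         \<or> (\<exists>\<tau>1 \<tau>2 a. is_sigma_mapping \<tau>1 \<and> is_sigma_mapping \<tau>2 \<and> a \<in> even_words \<and>
              acts_as_on \<phi> \<tau>1 even_words \<and>
              acts_as_on \<phi> (translation a \<circ> \<tau>2) odd_words)"
      (is "?I \<or> ?II \<or> ?III")
    proof (cases "\<pi>1 None = None")
      case True
      note iso1 = isometry_perm_word[OF 1 True]
      have "\<pi>2 None \<noteq> None"
        using even_isometry_if_on_classes[OF bij iso1 isometry_translation_comp even odd]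
          isometry_perm_word[OF 2] not by blast
      then have ?I
        using \<sigma>[OF 2] a odd even even_isometry_if_isometry[OF iso1]
        unfolding acts_as_even_isometry_on_def by blast
      then show ?thesis by blast
    next
      case False
      then have \<sigma>1: "is_sigma_mapping (perm_word \<pi>1)" by (rule \<sigma>[OF 1])
      show ?thesis
      proof (cases "\<pi>2 None = None")
        case True
        then have ?II
          using \<sigma>1 even odd
            even_isometry_if_isometry[OF isometry_translation_comp[OF isometry_perm_word[OF 2]]]
          unfolding acts_as_even_isometry_on_def by blast
        then show ?thesis by blast
      next
        case False
        then have ?III using \<sigma>1 \<sigma>[OF 2] even odd a by blast
        then show ?thesis by blast
      qed
    qed
  }
qed

end
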